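(* Let $a>0$ and $b>0$. With $V(p,n,a,\beta,x)$ and $\Upsilon_e,\Upsilon_o$ as defined in the context, the following hold on $(0,\infty)$: (i) for $p\in\{0,1,2\}$, $$\sqrt{2\pi}\int x^{\frac12+p}e^{-ax^{2}}b^{\frac12}Y_{\frac12}(bx)\,dx=-\int 2e^{-ax^{2}}x^{p}\cos(bx)\,dx=-V(p,0,a,ib,x)-V(p,0,a,-ib,x),$$ and for $p=0$ this equals $-\frac{\sqrt\pi}{2\sqrt a}e^{-\frac{b^{2}}{4a}}\left(\operatorname{erf}\left(\frac{2ax-ib}{2\sqrt a}\right)+\operatorname{erf}\left(\frac{2ax+ib}{2\sqrt a}\right)\right)$; (ii) $$\sqrt{2\pi}\int x^{\frac12-1}e^{-ax^{2}}b^{\frac32}Y_{\frac32}(bx)\,dx=\int\frac bx e^{-ax^{2}}\left(-2\sin(bx)-\frac{2\cos(bx)}{bx}\right)dx$$ $$=\sqrt\pi\sqrt a\,e^{-\frac{b^{2}}{4a}}\operatorname{erf}\left(\frac{2ax-ib}{2\sqrt a}\right)+\sqrt\pi\sqrt a\,e^{-\frac{b^{2}}{4a}}\operatorname{erf}\left(\frac{2ax+ib}{2\sqrt a}\right)+\frac1x\left(e^{-ax^{2}-ibx}+e^{-ax^{2}+ibx}\right)$$ $$=-V(-1,1,a,ib,x)-V(-1,1,a,-ib,x);$$ (iii) $$\sqrt{2\pi}\int x^{\frac12}e^{-ax^{2}}b^{\frac32}Y_{\frac32}(bx)\,dx=\int be^{-ax^{2}}\left(-\frac{2\cos(bx)}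{bx}-2\sin(bx)\right)dx=-2\,\Upsilon_e(1,a,ib,x)-2ib\,\Upsilon_o(0,a,ib,x).$$
   Context: $Y_\mu$ is the Bessel function of the second kind (Neumann function); $\operatorname{erf}(z)=\frac{2}{\sqrt\pi}\int_0^z e^{-t^2}dt$ is the entire error function; $\Gamma(s,z)=\int_z^\infty t^{s-1}e^{-t}dt$. For $\beta\in\mathbb{C}$, with $E=e^{-ax^{2}-\beta x}$ and $W=\sqrt\pi\,e^{\frac{\beta^{2}}{4a}}\operatorname{erf}\left(\frac{2ax+\beta}{2\sqrt a}\right)$: $$V(0,0,a,\beta,x)=\frac{W}{2\sqrt a},\quad V(1,0,a,\beta,x)=-\frac{E}{2a}-\frac{\beta W}{4a^{3/2}},$$ $$V(2,0,a,\beta,x)=\frac{(\beta-2ax)E}{4a^{2}}+\frac{(2a+\beta^{2})W}{8a^{5/2}},\quad V(-1,1,a,\beta,x)=-\sqrt a\,W-\frac Ex.$$ For $x>0$ and $\beta\in\mathbb{C}$, $$\Upsilon_e(\upsilon,a,\beta,x)=-\sum_{k=0}^\infty\frac{\beta^{2k}a^{-k+\frac\upsilon2-\frac12}\Gamma\left(k-\frac\upsilon2+\frac12,ax^2\right)}{2(2k)!},\quad \Upsilon_o(\upsilon,a,\beta,x)=\sum_{k=0}^\infty\frac{\beta^{2k+1}a^{-k+\frac\upsilon2-1}\Gamma\left(k-\frac\upsilon2+1,ax^2\right)}{2(2k+1)!}.$$ An identity $\int f\,dx=\int g\,dx=F$ means that $f=g$ on $(0,\infty)$ and $F$ is an antiderivative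 of it there. *)

theory Defs
  imports "HOL-Complex_Analysis.Complex_Analysis"
begin

definition bessel_J :: "complex \<Rightarrow> complex \<Rightarrow> complex" where
  "bessel_J \<mu> z = (z / 2) powr \<mu> *
     (\<Sum>k. (-1) ^ k / fact k * rGamma (\<mu> + of_nat k + 1) * (z / 2) ^ (2 * k))"

text \<open>At integer order the defining quotient is of the form 0/0 and is replaced by its limit
  in the order. Powers and hence both Bessel functions are on the principal branch.\<close>

definition bessel_Y :: "complex \<Rightarrow> complex \<Rightarrow> complex" where
  "bessel_Y \<mu> z =
     (let q = (\<lambda>\<nu>. (bessel_J \<nu> z * cos (\<nu> * of_real pi) - bessel_J (- \<nu>) z) / sin (\<nu> * of_real pi))
      in if \<mu> \<in> \<int> then Lim (at \<mu>) q else q \<mu>)"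

definition erf :: "complex \<Rightarrow> complex" where
  "erf z = 2 / of_real (sqrt pi) * contour_integral (linepath 0 z) (\<lambda>t. exp (- (t ^ 2)))"

text \<open>Only arguments \<open>z = a * x\<^sup>2 > 0\<close> occur, so the path of integration is the real half-line.\<close>

definition upper_Gamma :: "complex \<Rightarrow> real \<Rightarrow> complex" where
  "upper_Gamma s z = integral {z..} (\<lambda>t. of_real t powr (s - 1) * of_real (exp (- t)))"

definition V_E :: "real \<Rightarrow> complex \<Rightarrow> real \<Rightarrow> complex" where
  "V_E a \<beta> x = exp (- of_real (a * x ^ 2) - \<beta> * of_real x)"

definition V_W :: "real \<Rightarrow> complex \<Rightarrow> real \<Rightarrow> complex" where
  "V_W a \<beta> x = of_real (sqrt pi) * exp (\<beta> ^ 2 / (4 * of_real a)) *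
     erf ((of_real (2 * a * x) + \<beta>) / of_real (2 * sqrt a))"

text \<open>Closed forms for the four index pairs that are needed; no value is specified for the others.\<close>

definition V :: "int \<Rightarrow> int \<Rightarrow> real \<Rightarrow> complex \<Rightarrow> real \<Rightarrow> complex" where
  "V p n a \<beta> x =
    (let E = V_E a \<beta> x; W = V_W a \<beta> x in
     if (p, n) = (0, 0) then W / of_real (2 * sqrt a)
     else if (p, n) = (1, 0) then - E / of_real (2 * a) - \<beta> * W / of_real (4 * a powr (3/2))
     else if (p, n) = (2, 0) then (\<beta> - of_real (2 * a * x)) * E / of_real (4 * a ^ 2)
            + (of_real (2 * a) + \<beta> ^ 2) * W / of_real (8 * a powr (5/2))
     else if (p, n) = (-1, 1) then - of_real (sqrt a) * W - E / of_real x
     else undefined)"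

definition Upsilon_e :: "complex \<Rightarrow> real \<Rightarrow> complex \<Rightarrow> real \<Rightarrow> complex" where
  "Upsilon_e \<upsilon> a \<beta> x = - (\<Sum>k. \<beta> ^ (2 * k) * of_real a powr (- of_nat k + \<upsilon> / 2 - 1 / 2) *
     upper_Gamma (of_nat k - \<upsilon> / 2 + 1 / 2) (a * x ^ 2) / (2 * fact (2 * k)))"

definition Upsilon_o :: "complex \<Rightarrow> real \<Rightarrow> complex \<Rightarrow> real \<Rightarrow> complex" where
  "Upsilon_o \<upsilon> a \<beta> x = (\<Sum>k. \<beta> ^ (2 * k + 1) * of_real a powr (- of_nat k + \<upsilon> / 2 - 1) *
     upper_Gamma (of_nat k - \<upsilon> / 2 + 1) (a * x ^ 2) / (2 * fact (2 * k + 1)))"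

text \<open>The meaning of a chain \<open>\<integral> f dx = \<integral> g dx = F\<close> of indefinite integrals on \<open>(0, \<infinity>)\<close>.\<close>

definition indefinite_integrals_eq ::
  "(real \<Rightarrow> complex) \<Rightarrow> (real \<Rightarrow> complex) \<Rightarrow> (real \<Rightarrow> complex) \<Rightarrow> bool" where
  "indefinite_integrals_eq f g F \<longleftrightarrow>
     (\<forall>x>0. f x = g x) \<and> (\<forall>x>0. (F has_vector_derivative f x) (at x))"

end

(* At half-integer order the Bessel functions are elementary, because the values of 1/Gamma at
   half-integers turn the defining series into those of cos and sin; so the integrands are
   Gaussians times trigonometric functions. For (i) and (ii) one differentiates erf of an affine
   argument. For (iii), differentiating the incomplete Gamma function turns the k-th term of the
   Upsilon series into exp(-a x^2) times the k-th Taylor term of cos or sin; termwise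
   differentiation is justified by Gamma(k, z) <= (k-1)! and k!^2 <= (2k)!. *)

theory Submission imports Defs begin

section \<open>The error function\<close>

text \<open>A chain of indefinite integrals asks only for equal integrands and a derivative, so no
  integral is evaluated: every claimed antiderivative is differentiated. The values at \<beta> =
  \<open>\<i> * b\<close> and \<beta> = \<open>- \<i> * b\<close> come in pairs because their
  exponentials add up to 2 cos(b x) and, weighted with \<beta>, to 2 b sin(b x). The obstacle in
  (iii) is the summand cos(b x) / x with its pole at 0. It puts the order-zero function Gamma(0, a
  x^2) at the head of the cosine series; this grows logarithmically near 0 and escapes the factorial
  bound. Hence the estimates start at k = 1, and uniform convergence is shown on neighbourhoods of x
  that stay away from 0. The cosine and sine series differ by an offset m = 0 or m = 1, both in the
  Taylor exponent and in the Gamma order, so one argument with m as a parameter covers both.\<close>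

lemma erf_has_field_derivative:
  "(erf has_field_derivative 2 / of_real (sqrt pi) * exp (- (z ^ 2))) (at z)"
proof -
  \<comment> \<open>An entire integrand has a primitive g on the convex set \<open>UNIV\<close>,
    which turns the integral along the segment into g z - g 0.\<close>
  have "(\<lambda>t::complex. exp (- (t ^ 2))) holomorphic_on UNIV"
    by (intro holomorphic_intros)
  then obtain g where "\<And>z::complex. (g has_field_derivative exp (- (z ^ 2))) (at z within UNIV)"
    by (rule holomorphic_convex_primitive'[OF convex_UNIV open_UNIV]) auto
  then have g: "(g has_field_derivative exp (- (z ^ 2))) (at z)" for z :: complex
    by simp
  have "erf z = 2 / of_real (sqrt pi) * (g z - g 0)" for z
    using contour_integral_primitive[of UNIV g "\<lambda>t. exp (- (t ^ 2))" "linepath 0 z"] g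
    by (simp add: erf_def contour_integral_unique)
  then have "erf = (\<lambda>z. 2 / of_real (sqrt pi) * (g z - g 0))"
    by blast
  moreover have "((\<lambda>z. 2 / of_real (sqrt pi) * (g z - g 0)) has_field_derivative
      2 / of_real (sqrt pi) * (exp (- (z ^ 2)) - 0)) (at z)"
    by (intro DERIV_cmult DERIV_diff g DERIV_const)
  ultimately show ?thesis
    by simp
qed

section \<open>Bessel functions of half-integer order\<close>

text \<open>Induction along z * rGamma(z + 1) = rGamma z, starting from Gamma(1/2) = sqrt pi. The
  reciprocal is used because it is what the Bessel series contains.\<close>

lemma rGamma_half_plus_nat:
  "rGamma (of_nat k + 1/2 :: complex) = 4 ^ k * fact k / (fact (2 * k) * of_real (sqrt pi))"
proof (induction k)
  case 0
  show ?case
    by (simp add: rGamma_inverse_Gamma Gamma_one_half_complex field_simps)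
next
  case (Suc k)
  have "(of_nat k + 1/2) * rGamma (of_nat (Suc k) + 1/2 :: complex) = rGamma (of_nat k + 1/2)"
    using rGamma_plus1[of "of_nat k + 1/2 :: complex"] by (simp add: add_ac)
  moreover have "of_nat k + 1/2 \<noteq> (0 :: complex)"
    by (auto simp: complex_eq_iff)
  ultimately have "rGamma (of_nat (Suc k) + 1/2 :: complex) =
      4 ^ k * fact k / (fact (2 * k) * of_real (sqrt pi)) / (of_nat k + 1/2)"
    by (metis Suc.IH nonzero_mult_div_cancel_left)
  also have "\<dots> = 4 ^ Suc k * fact (Suc k) / (fact (2 * Suc k) * of_real (sqrt pi))"
  proof -
    \<comment> \<open>With m = k + 1 and p = 2 k + 1, the factors m * f and 2 * m * (p * F) are (k +
      1)! and (2 k + 2)!; the common m cancels.\<close>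
    have alg: "q * f / (F * r) / (p / 2) = 4 * q * (m * f) / (2 * m * (p * F) * r)"
      if "m \<noteq> 0" for q f F r p m :: complex
      using that by (simp add: mult_ac)
    have half: "of_nat k + 1/2 = (2 * of_nat k + 1 :: complex) / 2"
      by simp
    have fact2: "fact (2 * Suc k) = (2 * (1 + of_nat k) * ((2 * of_nat k + 1) * fact (2 * k)) :: complex)"
      by (simp add: algebra_simps)
    have "1 + of_nat k \<noteq> (0 :: complex)"
      by (auto simp: complex_eq_iff)
    from alg[OF this] show ?thesis
      by (simp only: half fact2 power_Suc fact_Suc of_nat_Suc)
  qed
  finally show ?case .
qed

text \<open>\<open>cos_coeff\<close> vanishes at odd indices, so dropping them is a reindexing along
  n -> 2 * n. Both fields are covered because the complex case sums the Bessel series and the real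
  case the Upsilon series.\<close>

lemma cos_sums_even: "(\<lambda>k. (-1) ^ k / fact (2 * k) * z ^ (2 * k)) sums cos (z :: 'a::{real_normed_field,banach})"
proof -
  have "(\<lambda>n. cos_coeff n *\<^sub>R z ^ n) sums cos z"
    by (rule cos_converges)
  also have "?this \<longleftrightarrow> (\<lambda>k. (-1) ^ k / fact (2 * k) * z ^ (2 * k)) sums cos z"
    by (subst sums_mono_reindex[of "\<lambda>n. 2 * n", symmetric])
       (auto simp: cos_coeff_def strict_mono_def scaleR_conv_of_real elim!: evenE)
  finally show ?thesis .
qed

lemma sin_sums_odd: "(\<lambda>k. (-1) ^ k / fact (2 * k + 1) * z ^ (2 * k + 1)) sums sin (z :: 'a::{real_normed_field,banach})"
proof -
  have "(\<lambda>n. sin_coeff n *\<^sub>R z ^ n) sums sin z"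
    by (rule sin_converges)
  also have "?this \<longleftrightarrow> (\<lambda>k. (-1) ^ k / fact (2 * k + 1) * z ^ (2 * k + 1)) sums sin z"
    by (subst sums_mono_reindex[of "\<lambda>n. 2 * n + 1", symmetric])
       (auto simp: sin_coeff_def strict_mono_def scaleR_conv_of_real elim!: oddE)
  finally show ?thesis .
qed

section \<open>Bessel functions of the first kind at orders -1/2 and -3/2\<close>

lemma bessel_J_minus_half:
  "bessel_J (- (1/2)) z = (z / 2) powr (- (1/2)) * (cos z / of_real (sqrt pi))"
proof -
  have "(\<lambda>k. (-1) ^ k / fact (2 * k) * z ^ (2 * k) / of_real (sqrt pi)) sums
        (cos z / of_real (sqrt pi))"
    by (intro sums_divide cos_sums_even)
  moreover have "(-1) ^ k / fact k * rGamma (- (1/2) + of_nat k + 1) * (z / 2) ^ (2 * k) =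
      (-1) ^ k / fact (2 * k) * z ^ (2 * k) / of_real (sqrt pi)" for k
  proof -
    have "- (1/2) + of_nat k + 1 = (of_nat k + 1/2 :: complex)"
      by simp
    then show ?thesis
      by (simp only: rGamma_half_plus_nat) (simp add: power_mult power_divide)
  qed
  ultimately show ?thesis
    by (simp only: bessel_J_def sums_iff)
qed

text \<open>Compared with order -1/2, the Gamma factor gains k - 1/2, that is (2 k - 1) / 2. The
  part 2 k acts on the cosine series as z d/dz and gives - z sin z; the part -1 gives - cos
  z.\<close>

lemma bessel_J_minus_three_halves:
  "bessel_J (- (3/2)) z =
     (z / 2) powr (- (3/2)) * ((- z * sin z - cos z) / (2 * of_real (sqrt pi)))"
proof -
  let ?s = "\<lambda>k. (-1) ^ k * of_nat (2 * k) / fact (2 * k) * z ^ (2 * k)"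
  have "(\<lambda>k. - z * ((-1) ^ k / fact (2 * k + 1) * z ^ (2 * k + 1))) sums (- z * sin z)"
    by (intro sums_mult sin_sums_odd)
  moreover have "- z * ((-1) ^ k / fact (2 * k + 1) * z ^ (2 * k + 1)) = ?s (Suc k)" for k
  proof -
    have "fact (2 * Suc k) = of_nat (2 * Suc k) * (fact (2 * k + 1) :: complex)"
      by simp
    moreover have "of_nat (2 * Suc k) \<noteq> (0 :: complex)"
      by (simp only: of_nat_eq_0_iff) simp
    ultimately show ?thesis
      by (simp add: divide_simps del: fact_Suc of_nat_Suc of_nat_mult)
  qed
  ultimately have "(\<lambda>k. ?s (Suc k)) sums (- z * sin z)"
    by simp
  \<comment> \<open>The factor 2 k makes the term at k = 0 vanish, so the shift of the index does
    not change the sum.\<close>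
  then have "?s sums (- z * sin z)"
    by (subst (asm) sums_Suc_iff) simp
  then have "(\<lambda>k. (?s k - (-1) ^ k / fact (2 * k) * z ^ (2 * k)) / (2 * of_real (sqrt pi))) sums
        ((- z * sin z - cos z) / (2 * of_real (sqrt pi)))"
    by (intro sums_divide sums_diff cos_sums_even)
  moreover have "(-1) ^ k / fact k * rGamma (- (3/2) + of_nat k + 1) * (z / 2) ^ (2 * k) =
      (?s k - (-1) ^ k / fact (2 * k) * z ^ (2 * k)) / (2 * of_real (sqrt pi))" for k
  proof -
    have "rGamma (- (3/2) + of_nat k + 1 :: complex) = (of_nat k - 1/2) * rGamma (of_nat k + 1/2)"
      using rGamma_plus1[of "of_nat k - 1/2 :: complex"] by (simp add: algebra_simps)
    then have "(-1) ^ k / fact k * rGamma (- (3/2) + of_nat k + 1) * (z / 2) ^ (2 * k) =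
        (-1) ^ k / fact k * ((of_nat k - 1/2) * (4 ^ k * fact k / (fact (2 * k) * of_real (sqrt pi))))
          * (z ^ (2 * k) / 4 ^ k)"
      by (simp only: rGamma_half_plus_nat power_divide) (simp add: power_mult)
    also have "\<dots> = ((-1) ^ k * (2 * of_nat k) / fact (2 * k) * z ^ (2 * k)
        - (-1) ^ k / fact (2 * k) * z ^ (2 * k)) / (2 * of_real (sqrt pi))"
    proof -
      have alg: "c / f * ((n - 1/2) * (q * f / (F * r))) * (w / q) = (c * (2 * n) / F * w - c / F * w) / (2 * r)"
        if "f \<noteq> 0" "q \<noteq> 0" "F \<noteq> 0" "r \<noteq> 0" for c f n q F r w :: complex
        using that by (simp add: divide_simps) (simp add: algebra_simps)
      show ?thesis
        by (rule alg) simp_all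
    qed
    finally show ?thesis
      by simp
  qed
  ultimately show ?thesis
    by (simp only: bessel_J_def sums_iff)
qed

section \<open>Bessel functions of the second kind at orders 1/2 and 3/2\<close>

lemma odd_half_not_Ints: "odd n \<Longrightarrow> (of_int n / 2 :: complex) \<notin> \<int>"
proof
  assume "odd n" "(of_int n / 2 :: complex) \<in> \<int>"
  then obtain m where "(of_int n / 2 :: complex) = of_int m"
    by (auto elim: Ints_cases)
  then have "(of_int n :: complex) = of_int (2 * m)"
    by (simp add: field_simps)
  then show False
    using \<open>odd n\<close> by (simp only: of_int_eq_iff) simp
qed

text \<open>The order is not an integer, so the quotient itself applies; cos(pi/2) = 0 removes J of
  order 1/2 and only - J of order -1/2 is left. At order 3/2 the sine in the denominator is -1,
  which flips that sign.\<close>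

lemma bessel_Y_half:
  assumes "x > 0"
  shows "bessel_Y (1/2) (of_real x) = of_real (- sqrt (2 / pi) * x powr (- (1/2)) * cos x)"
proof -
  have "(1/2 :: complex) \<notin> \<int>"
    using odd_half_not_Ints[of 1] by simp
  moreover have "cos (1/2 * of_real pi :: complex) = 0" "sin (1/2 * of_real pi :: complex) = 1"
    using cos_of_real[of "pi/2", where 'a=complex] sin_of_real[of "pi/2", where 'a=complex]
    by simp_all
  ultimately have "bessel_Y (1/2) (of_real x) = - bessel_J (- (1/2)) (of_real x)"
    by (simp add: bessel_Y_def)
  also have "\<dots> = - ((of_real x / 2) powr (- (1/2)) * (cos (of_real x) / of_real (sqrt pi)))"
    by (simp only: bessel_J_minus_half)
  also have "(of_real x / 2) powr (- (1/2) :: complex) = of_real ((x / 2) powr (- (1/2)))"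
    using powr_of_real[of "x/2" "- (1/2)"] assms by simp
  also have "(x / 2) powr (- (1/2)) = sqrt 2 * x powr (- (1/2))"
    using assms by (simp add: powr_divide powr_minus powr_half_sqrt field_simps)
  finally show ?thesis
    by (simp add: real_sqrt_divide cos_of_real)
qed

lemma bessel_Y_three_halves:
  assumes "x > 0"
  shows "bessel_Y (3/2) (of_real x) =
    of_real (sqrt (2 / pi) * x powr (- (1/2)) * (- sin x - cos x / x))"
proof -
  have "(3/2 :: complex) \<notin> \<int>"
    using odd_half_not_Ints[of 3] by simp
  moreover have "cos (3/2 * pi) = 0" "sin (3/2 * pi) = - 1"
    using cos_periodic_pi[of "pi/2"] sin_periodic_pi[of "pi/2"] by (simp_all add: field_simps)
  then have "cos (3/2 * of_real pi :: complex) = 0" "sin (3/2 * of_real pi :: complex) = - 1"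
    using cos_of_real[of "3/2 * pi", where 'a=complex] sin_of_real[of "3/2 * pi", where 'a=complex]
    by simp_all
  ultimately have "bessel_Y (3/2) (of_real x) = bessel_J (- (3/2)) (of_real x)"
    by (simp add: bessel_Y_def)
  also have "\<dots> = (of_real x / 2) powr (- (3/2)) *
      ((- of_real x * sin (of_real x) - cos (of_real x)) / (2 * of_real (sqrt pi)))"
    by (simp only: bessel_J_minus_three_halves)
  also have "(of_real x / 2) powr (- (3/2) :: complex) = of_real ((x / 2) powr (- (3/2)))"
    using powr_of_real[of "x/2" "- (3/2)"] assms by simp
  \<comment> \<open>The factor 2 / x is split off so that the same power x^(-1/2) remains as at
    order 1/2.\<close>
  also have "(x / 2) powr (- (3/2)) = 2 * sqrt 2 * x powr (- (1/2)) / x"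
  proof -
    have "(x / 2) powr (- (3/2)) = (x / 2) powr (- (1/2)) * (x / 2) powr (- 1)"
      using powr_add[of "x / 2" "- (1/2)" "- 1"] by simp
    also have "(x / 2) powr (- (1/2)) = sqrt 2 * x powr (- (1/2))"
      using assms by (simp add: powr_divide powr_minus powr_half_sqrt field_simps)
    finally show ?thesis
      using assms by (simp add: powr_minus)
  qed
  also have "of_real (2 * sqrt 2 * x powr (- (1/2)) / x) *
        ((- of_real x * sin (of_real x) - cos (of_real x)) / (2 * of_real (sqrt pi))) =
      (of_real (2 * sqrt 2 * x powr (- (1/2)) / x * ((- x * sin x - cos x) / (2 * sqrt pi))) :: complex)"
    by (simp add: cos_of_real sin_of_real)
  also have "2 * sqrt 2 * x powr (- (1/2)) / x * ((- x * sin x - cos x) / (2 * sqrt pi)) =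
      sqrt (2 / pi) * x powr (- (1/2)) * (- sin x - cos x / x)"
    using assms by (simp add: real_sqrt_divide field_simps)
  finally show ?thesis .
qed

section \<open>The incomplete Gamma function and the Upsilon series\<close>

text \<open>Real counterpart of \<open>upper_Gamma\<close>, open to sign arguments and real
  differentiation; the integrand has the shape of Euler's integral for Gamma, so that the two can be
  compared.\<close>

definition upper_Gamma_real :: "real \<Rightarrow> real \<Rightarrow> real" where
  "upper_Gamma_real s z = integral {z..} (\<lambda>t. t powr (s - 1) / exp t)"

text \<open>Order s = 0 occurs, where Euler's integral diverges at 0. Raising the order to s' = max
  s 1 restores convergence, and for t \<ge> z the lost factor t^(s - s') is at most z^(s - s'), its
  exponent being nonpositive.\<close>

lemma upper_Gamma_integrable:
  fixes s z :: real
  assumes "0 < z"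
  shows "(\<lambda>t. t powr (s - 1) / exp t) integrable_on {z..}"
proof -
  define s' :: real where "s' = max s 1"
  have "(\<lambda>t. t powr (s' - 1) / exp t) integrable_on {0..}"
    by (rule has_integral_integrable[OF Gamma_integral_real]) (simp add: s'_def)
  then have "(\<lambda>t. t powr (s' - 1) / exp t) absolutely_integrable_on {0..}"
    by (rule nonnegative_absolutely_integrable_1) simp
  then have "(\<lambda>t. t powr (s' - 1) / exp t) absolutely_integrable_on {z..}"
    by (rule set_integrable_subset) (use assms in auto)
  then have int: "(\<lambda>t. z powr (s - s') * (t powr (s' - 1) / exp t)) integrable_on {z..}"
    by (intro integrable_on_mult_right) (simp add: absolutely_integrable_on_def)
  show ?thesis
  proof (rule measurable_bounded_by_integrable_imp_integrable[OF _ int])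
    show "(\<lambda>t. t powr (s - 1) / exp t) \<in> borel_measurable (lebesgue_on {z..})"
      by (intro continuous_imp_measurable_on_sets_lebesgue continuous_intros) (use assms in auto)
    fix t assume t: "t \<in> {z..}"
    have "t powr (s - 1) = t powr (s - s') * t powr (s' - 1)"
      by (simp flip: powr_add)
    also have "\<dots> \<le> z powr (s - s') * t powr (s' - 1)"
      using t assms by (intro mult_right_mono powr_mono2') (auto simp: s'_def)
    finally show "norm (t powr (s - 1) / exp t) \<le> z powr (s - s') * (t powr (s' - 1) / exp t)"
      by (simp add: divide_right_mono)
  qed auto
qed

lemma upper_Gamma_of_real:
  assumes "0 < z"
  shows "upper_Gamma (of_real s) z = of_real (upper_Gamma_real s z)"
proof -
  have "((\<lambda>t. complex_of_real (t powr (s - 1) / exp t)) has_integral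
      of_real (upper_Gamma_real s z)) {z..}"
    using has_integral_linear[OF integrable_integral[OF upper_Gamma_integrable[OF assms]]
        bounded_linear_of_real[where 'a = complex]]
    by (simp only: o_def upper_Gamma_real_def)
  then have "((\<lambda>t. complex_of_real t powr (of_real s - 1) * of_real (exp (- t))) has_integral
      of_real (upper_Gamma_real s z)) {z..}"
  proof (rule has_integral_eq[rotated])
    fix t assume "t \<in> {z..}"
    then show "complex_of_real (t powr (s - 1) / exp t) =
        complex_of_real t powr (of_real s - 1) * of_real (exp (- t))"
      using assms powr_of_real[of t "s - 1"] by (simp add: exp_minus field_simps)
  qed
  then show ?thesis
    by (simp add: upper_Gamma_def integral_unique)
qed

text \<open>Cutting the half-line at 2 z leaves a constant tail and a compact integral with moving
  lower limit, whence the minus sign. The left end z / 2 keeps a possible singularity at 0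
  away.\<close>

lemma upper_Gamma_real_has_real_derivative:
  assumes "0 < z"
  shows "(upper_Gamma_real s has_real_derivative - (z powr (s - 1) / exp z)) (at z)"
proof -
  let ?g = "\<lambda>t. t powr (s - 1) / exp t"
  let ?c = "2 * z"
  have eq: "upper_Gamma_real s y = integral {y..?c} ?g + upper_Gamma_real s ?c"
    if "y \<in> {z/2<..<?c}" for y
  proof -
    have "?g integrable_on {y..?c}"
      by (intro integrable_continuous_real continuous_intros) (use that assms in auto)
    moreover have "{y..?c} \<inter> {?c..} = {?c}" "{y..?c} \<union> {?c..} = {y..}"
      using that by auto
    ultimately show ?thesis
      using upper_Gamma_integrable[of ?c s] assms integral_Un[of ?g "{y..?c}" "{?c..}"]
      by (simp add: upper_Gamma_real_def)
  qed
  have "((\<lambda>y. integral {y..?c} ?g) has_real_derivative - ?g z) (at z within {z/2..?c})"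
    by (rule integral_has_real_derivative') (use assms in \<open>auto intro!: continuous_intros\<close>)
  then have "((\<lambda>y. integral {y..?c} ?g + upper_Gamma_real s ?c) has_real_derivative - ?g z) (at z)"
    using assms by (auto intro!: derivative_eq_intros simp: at_within_Icc_at)
  then show ?thesis
    by (rule has_field_derivative_transform_within_open[of _ _ _ "{z/2<..<?c}"])
       (use assms eq in auto)
qed

text \<open>If the integrand is not integrable, \<open>integral\<close> has the default value
  0.\<close>

lemma upper_Gamma_real_nonneg: "0 \<le> upper_Gamma_real s z"
  unfolding upper_Gamma_real_def by (cases "(\<lambda>t. t powr (s - 1) / exp t) integrable_on {z..}")
     (auto intro!: integral_nonneg simp: not_integrable_integral)

lemma upper_Gamma_real_le_Gamma:
  assumes "0 < s" "0 < z"
  shows "upper_Gamma_real s z \<le> Gamma s"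
proof -
  have "upper_Gamma_real s z \<le> integral {0..} (\<lambda>t. t powr (s - 1) / exp t)"
    unfolding upper_Gamma_real_def
    using assms Gamma_integral_real[of s]
    by (intro integral_subset_le upper_Gamma_integrable has_integral_integrable) auto
  then show ?thesis
    using Gamma_integral_real[of s] assms by (simp add: integral_unique)
qed

text \<open>The slack in n \<le> k + 1 gives one bound k! for order k (cosine series) and order k +
  1 (sine series).\<close>

lemma upper_Gamma_real_nat_le_fact:
  assumes "0 < n" "n \<le> Suc k" "0 < z"
  shows "upper_Gamma_real (real n) z \<le> fact k"
proof -
  obtain j where j: "n = Suc j" "j \<le> k"
    using assms by (cases n) auto
  have "upper_Gamma_real (real n) z \<le> Gamma (real n)"
    using assms by (intro upper_Gamma_real_le_Gamma) auto
  also have "\<dots> = fact j"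
    using Gamma_fact[of j, where 'a = real] by (simp add: j add.commute)
  also have "\<dots> \<le> fact k"
    by (rule fact_mono) (fact j)
  finally show ?thesis .
qed

section \<open>Termwise differentiation of series of incomplete Gamma functions\<close>

lemma upper_Gamma_real_square_has_real_derivative:
  assumes "0 < a" "0 < y"
  shows "((\<lambda>y. upper_Gamma_real (real n) (a * y ^ 2)) has_real_derivative
    - (2 * a ^ n * y ^ (2 * n) * exp (- (a * y ^ 2)) / y)) (at y)"
proof -
  have pos: "0 < a * y ^ 2"
    using assms by simp
  have "((\<lambda>y. upper_Gamma_real (real n) (a * y ^ 2)) has_real_derivative
      - ((a * y ^ 2) powr (real n - 1) / exp (a * y ^ 2)) * (2 * a * y)) (at y)"
    by (rule DERIV_chain2[where f = "upper_Gamma_real (real n)" and g = "\<lambda>y. a * y ^ 2", OF upper_Gamma_real_has_real_derivative[OF pos]])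
       (auto intro!: derivative_eq_intros)
  \<comment> \<open>The quotient form is valid also at n = 0, where a natural exponent n - 1 would
    be truncated to 0.\<close>
  moreover have "(a * y ^ 2) powr (real n - 1) = a ^ n * y ^ (2 * n) / (a * y ^ 2)"
    using pos by (simp only: powr_diff powr_realpow) (simp add: power_mult_distrib power_mult)
  moreover have "- (a ^ n * y ^ (2 * n) / (a * y ^ 2) / exp (a * y ^ 2)) * (2 * a * y) =
      - (2 * a ^ n * y ^ (2 * n) * exp (- (a * y ^ 2)) / y)"
    using assms by (simp add: exp_minus power2_eq_square divide_simps)
  ultimately show ?thesis
    by simp
qed

text \<open>The weight \<open>1 / a ^ (k + m)\<close> cancels the power of a that differentiation
  produces. The assumption on c is used at r = 1 / a for the series itself and at r = 4 x^2 for its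
  derivatives; the factor k! in it absorbs the Gamma bound.\<close>

lemma upper_Gamma_series:
  fixes a x :: real and c :: "nat \<Rightarrow> real"
  assumes a: "0 < a" and x: "0 < x" and m: "m \<le> 1"
    and c: "\<And>r. summable (\<lambda>k. \<bar>c k\<bar> * fact k * r ^ k)"
  defines "F \<equiv> \<lambda>k y. c k / a ^ (k + m) * upper_Gamma_real (real (k + m)) (a * y ^ 2)"
  shows summable_upper_Gamma_series: "summable (\<lambda>k. F k x)"
    and upper_Gamma_series_has_real_derivative:
      "((\<lambda>y. \<Sum>k. F k y) has_real_derivative
          (\<Sum>k. - (2 * c k * x ^ (2 * (k + m)) * exp (- (a * x ^ 2)) / x))) (at x)"
proof -
  \<comment> \<open>The restriction to k \<ge> 1 keeps the Gamma order positive when m = 0; a single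
    term does not affect summability.\<close>
  have "norm (F k x) \<le> \<bar>c k\<bar> * fact k * (1 / a) ^ k * (1 / a) ^ m" if "1 \<le> k" for k
  proof -
    have "upper_Gamma_real (real (k + m)) (a * x ^ 2) \<le> fact k"
      by (rule upper_Gamma_real_nat_le_fact) (use that m a x in auto)
    then have "\<bar>c k\<bar> / a ^ (k + m) * upper_Gamma_real (real (k + m)) (a * x ^ 2) \<le>
        \<bar>c k\<bar> / a ^ (k + m) * fact k"
      using a by (intro mult_left_mono) auto
    then show ?thesis
      using a upper_Gamma_real_nonneg[of "real (k + m)" "a * x ^ 2"]
      by (simp add: F_def abs_mult power_add power_one_over field_simps)
  qed
  then show F: "summable (\<lambda>k. F k x)"
    by (intro summable_comparison_test[OF _ summable_mult2[OF c]]) blast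
  let ?F' = "\<lambda>k y. - (2 * c k * y ^ (2 * (k + m)) * exp (- (a * y ^ 2)) / y)"
  \<comment> \<open>Bounded and away from 0: y < 2 x controls the powers of y, and y > x / 2
    controls the division by y.\<close>
  let ?S = "{x / 2<..<2 * x}"
  have deriv: "(F k has_real_derivative ?F' k y) (at y within ?S)" if "y \<in> ?S" for k y
  proof -
    have "0 < y"
      using that x by auto
    from DERIV_cmult[OF upper_Gamma_real_square_has_real_derivative[OF a this, of "k + m"],
        of "c k / a ^ (k + m)"]
    have "(F k has_real_derivative ?F' k y) (at y)"
      using a by (simp add: F_def mult_ac)
    then show ?thesis
      by (rule DERIV_subset) simp
  qed
  have conv: "uniformly_convergent_on ?S (\<lambda>n y. \<Sum>k<n. ?F' k y)"
  proof (rule Weierstrass_m_test')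
    show "summable (\<lambda>k. \<bar>c k\<bar> * fact k * (4 * x ^ 2) ^ k * (2 * (2 * x) ^ (2 * m) / (x / 2)))"
      by (intro summable_mult2 c)
    fix k y assume y: "y \<in> ?S"
    have "norm (?F' k y) = 2 * \<bar>c k\<bar> * y ^ (2 * (k + m)) * exp (- (a * y ^ 2)) / y"
      using y x by (simp add: abs_mult)
    \<comment> \<open>The factor k! \<ge> 1 is inserted only to bring the majorant into the form of
      the assumption on c.\<close>
    also have "\<dots> \<le> 2 * (\<bar>c k\<bar> * fact k) * (2 * x) ^ (2 * (k + m)) * 1 / (x / 2)"
      using y x a
      by (intro frac_le mult_mono power_mono mult_nonneg_nonneg zero_le_power)
         (auto simp: mult_le_cancel_left1)
    also have "\<dots> = \<bar>c k\<bar> * fact k * (4 * x ^ 2) ^ k * (2 * (2 * x) ^ (2 * m) / (x / 2))"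
      by (simp add: distrib_left power_add power_mult power_mult_distrib)
    finally show "norm (?F' k y) \<le> \<dots>" .
  qed
  show "((\<lambda>y. \<Sum>k. F k y) has_real_derivative (\<Sum>k. ?F' k x)) (at x)"
    by (rule has_field_derivative_series'(2)[OF _ deriv conv _ F])
       (use x in \<open>auto simp: interior_open\<close>)
qed

text \<open>Of the two factors k! that the denominator dominates, one pays for the Gamma bound; the
  other leaves the exponential series at b^2 * |r|.\<close>

lemma summable_fact_over_fact_double:
  fixes b r :: real
  shows "summable (\<lambda>k. \<bar>(-1) ^ k * b ^ (2 * k + m) / (2 * fact (2 * k + m))\<bar> * fact k * r ^ k)"
proof (rule summable_comparison_test)
  show "summable (\<lambda>k. \<bar>b\<bar> ^ m * (inverse (fact k) * (b ^ 2 * \<bar>r\<bar>) ^ k))"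
    by (intro summable_mult summable_exp)
  have "norm (\<bar>(-1) ^ k * b ^ (2 * k + m) / (2 * fact (2 * k + m))\<bar> * fact k * r ^ k) \<le>
      \<bar>b\<bar> ^ m * (inverse (fact k) * (b ^ 2 * \<bar>r\<bar>) ^ k)" for k
  proof -
    \<comment> \<open>The quotient is the central binomial coefficient, so divisibility gives the
      inequality.\<close>
    have "fact k * fact k \<le> (fact (k + k) :: nat)"
      by (intro dvd_imp_le fact_fact_dvd_fact) simp
    also have "\<dots> \<le> fact (2 * k + m)"
      by (intro fact_mono) simp
    finally have "real (fact k * fact k) \<le> real (fact (2 * k + m))"
      by (simp only: of_nat_le_iff)
    then have "fact k * fact k \<le> (fact (2 * k + m) :: real)"
      by simp
    also have "\<dots> \<le> 2 * fact (2 * k + m)"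
      by simp
    finally have "fact k * fact k \<le> (2 * fact (2 * k + m) :: real)" .
    then have "fact k / (2 * fact (2 * k + m)) \<le> inverse (fact k :: real)"
      by (simp add: field_simps)
    then have "fact k / (2 * fact (2 * k + m)) * (\<bar>b\<bar> ^ m * (b ^ 2 * \<bar>r\<bar>) ^ k) \<le>
        inverse (fact k :: real) * (\<bar>b\<bar> ^ m * (b ^ 2 * \<bar>r\<bar>) ^ k)"
      by (intro mult_right_mono) auto
    moreover have "\<bar>b ^ (2 * k + m)\<bar> = \<bar>b\<bar> ^ m * (b ^ 2) ^ k"
      by (simp add: power_add power_mult abs_mult power_abs)
    ultimately show ?thesis
      by (simp add: abs_mult power_abs power_mult_distrib mult_ac)
  qed
  then show "\<exists>N. \<forall>k\<ge>N. norm (\<bar>(-1) ^ k * b ^ (2 * k + m) / (2 * fact (2 * k + m))\<bar> * fact k * r ^ k) \<le>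
      \<bar>b\<bar> ^ m * (inverse (fact k) * (b ^ 2 * \<bar>r\<bar>) ^ k)"
    by blast
qed

text \<open>The common real form of both Upsilon series at \<beta> = \<open>\<i> * b\<close>: half
  the Taylor coefficients of cosine (m = 0) or sine (m = 1) in b. The half cancels the 2 from the
  derivative of a x^2.\<close>

definition upper_Gamma_trig_series :: "nat \<Rightarrow> real \<Rightarrow> real \<Rightarrow> real \<Rightarrow> real" where
  "upper_Gamma_trig_series m a b x =
     (\<Sum>k. (-1) ^ k * b ^ (2 * k + m) / (2 * fact (2 * k + m)) / a ^ (k + m) *
        upper_Gamma_real (real (k + m)) (a * x ^ 2))"

lemma upper_Gamma_trig_series_has_real_derivative:
  assumes "0 < a" "0 < x" "m \<le> 1"
    and "(\<lambda>k. (-1) ^ k / fact (2 * k + m) * (b * x) ^ (2 * k + m)) sums s"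
  shows "(upper_Gamma_trig_series m a b has_real_derivative
    - (x ^ m * exp (- (a * x ^ 2)) / x * s)) (at x)"
proof -
  let ?c = "\<lambda>k. (-1) ^ k * b ^ (2 * k + m) / (2 * fact (2 * k + m))"
  have "(\<lambda>k. - (x ^ m * exp (- (a * x ^ 2)) / x * ((-1) ^ k / fact (2 * k + m) * (b * x) ^ (2 * k + m))))
      sums - (x ^ m * exp (- (a * x ^ 2)) / x * s)"
    by (intro sums_minus sums_mult assms)
  also have "(\<lambda>k. - (x ^ m * exp (- (a * x ^ 2)) / x * ((-1) ^ k / fact (2 * k + m) * (b * x) ^ (2 * k + m)))) =
      (\<lambda>k. - (2 * ?c k * x ^ (2 * (k + m)) * exp (- (a * x ^ 2)) / x))"
  proof
    fix k
    \<comment> \<open>The second factor completes the Taylor power of b x. The first, over x, leaves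
      cos(b x) / x for m = 0 and sin(b x) for m = 1.\<close>
    have "x ^ (2 * (k + m)) = x ^ m * x ^ (2 * k + m)"
      by (simp add: mult_2 add_ac flip: power_add)
    then show "- (x ^ m * exp (- (a * x ^ 2)) / x * ((-1) ^ k / fact (2 * k + m) * (b * x) ^ (2 * k + m))) =
        - (2 * ?c k * x ^ (2 * (k + m)) * exp (- (a * x ^ 2)) / x)"
      by (simp only: power_mult_distrib) (simp add: mult_ac)
  qed
  finally have "(\<Sum>k. - (2 * ?c k * x ^ (2 * (k + m)) * exp (- (a * x ^ 2)) / x)) =
      - (x ^ m * exp (- (a * x ^ 2)) / x * s)"
    by (rule sums_unique[symmetric])
  with upper_Gamma_series_has_real_derivative[OF assms(1-3), of ?c, OF summable_fact_over_fact_double]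
  show ?thesis
    by (simp only: upper_Gamma_trig_series_def[abs_def])
qed

section \<open>The Upsilon series at purely imaginary argument\<close>

lemma of_real_powr_minus_nat:
  "0 < a \<Longrightarrow> complex_of_real a powr (- of_nat n) = of_real (1 / a ^ n)"
  using powr_of_real[of a "- real n"] by (simp add: powr_minus powr_realpow divide_inverse)

text \<open>At \<upsilon> = 1 the halves cancel: the Gamma order is k and the exponent of a is -k.
  Even powers of \<open>\<i> * b\<close> are real and supply the alternating sign.\<close>

lemma Upsilon_e_imaginary:
  assumes "0 < a" "0 < x"
  shows "Upsilon_e 1 a (\<i> * of_real b) x = - of_real (upper_Gamma_trig_series 0 a b x)"
proof -
  \<comment> \<open>The summands \<open>+ 0\<close> keep the terms literally equal to the instance m
    = 0 of the general series.\<close>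
  let ?t = "\<lambda>k. (-1) ^ k * b ^ (2 * k + 0) / (2 * fact (2 * k + 0)) / a ^ (k + 0) *
        upper_Gamma_real (real (k + 0)) (a * x ^ 2)"
  have "(\<i> * of_real b) ^ (2 * k) * of_real a powr (- of_nat k + 1 / 2 - 1 / 2) *
     upper_Gamma (of_nat k - 1 / 2 + 1 / 2) (a * x ^ 2) / (2 * fact (2 * k)) = of_real (?t k)" for k
  proof -
    have "- of_nat k + 1 / 2 - 1 / 2 = (- of_nat k :: complex)"
      "of_nat k - 1 / 2 + 1 / 2 = complex_of_real (real k)"
      by simp_all
    moreover have "(\<i> * of_real b) ^ (2 * k) = of_real ((-1) ^ k * b ^ (2 * k))"
      by (simp add: power_mult_distrib power_mult power_minus[of "(complex_of_real b)\<^sup>2"])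
    moreover have "0 < a * x ^ 2"
      using assms by simp
    ultimately show ?thesis
      by (simp only: of_real_powr_minus_nat[OF \<open>0 < a\<close>] upper_Gamma_of_real) (simp add: mult_ac)
  qed
  moreover have "summable ?t"
    by (intro summable_upper_Gamma_series assms summable_fact_over_fact_double) simp
  ultimately show ?thesis
    by (simp only: Upsilon_e_def upper_Gamma_trig_series_def suminf_of_real)
qed

text \<open>At \<upsilon> = 0 the Gamma order is k + 1 and the exponent of a is -(k + 1); the odd
  power of \<open>\<i> * b\<close> leaves one factor \<open>\<i>\<close>.\<close>

lemma Upsilon_o_imaginary:
  assumes "0 < a" "0 < x"
  shows "Upsilon_o 0 a (\<i> * of_real b) x = \<i> * of_real (upper_Gamma_trig_series 1 a b x)"
proof -
  let ?t = "\<lambda>k. (-1) ^ k * b ^ (2 * k + 1) / (2 * fact (2 * k + 1)) / a ^ (k + 1) *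
        upper_Gamma_real (real (k + 1)) (a * x ^ 2)"
  have "(\<i> * of_real b) ^ (2 * k + 1) * of_real a powr (- of_nat k + 0 / 2 - 1) *
     upper_Gamma (of_nat k - 0 / 2 + 1) (a * x ^ 2) / (2 * fact (2 * k + 1)) = \<i> * of_real (?t k)" for k
  proof -
    have "- of_nat k + 0 / 2 - 1 = (- of_nat (k + 1) :: complex)"
      "of_nat k - 0 / 2 + 1 = complex_of_real (real (k + 1))"
      by simp_all
    moreover have "(\<i> * of_real b) ^ (2 * k + 1) = \<i> * of_real ((-1) ^ k * b ^ (2 * k + 1))"
      by (simp add: power_mult_distrib power_mult power_minus[of "(complex_of_real b)\<^sup>2"])
    moreover have "0 < a * x ^ 2"
      using assms by simp
    ultimately show ?thesis
      by (simp only: of_real_powr_minus_nat[OF \<open>0 < a\<close>] upper_Gamma_of_real) (simp add: mult_ac)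
  qed
  moreover have t: "summable ?t"
    by (intro summable_upper_Gamma_series assms summable_fact_over_fact_double) simp
  moreover have "summable (\<lambda>k. complex_of_real (?t k))"
    using t by (simp only: summable_of_real_iff)
  ultimately show ?thesis
    by (simp only: Upsilon_o_def upper_Gamma_trig_series_def suminf_of_real suminf_mult)
qed

section \<open>Derivatives of the functions V\<close>

lemma gaussian_linear_has_field_derivative:
  fixes A \<beta> z :: complex
  shows "((\<lambda>z. exp (- (A * z ^ 2) - \<beta> * z)) has_field_derivative
    (- (2 * A * z) - \<beta>) * exp (- (A * z ^ 2) - \<beta> * z)) (at z)"
  by (auto intro!: derivative_eq_intros simp: algebra_simps)

lemma erf_affine_has_field_derivative:
  fixes r \<beta> z :: complex
  assumes "r \<noteq> 0"
  shows "((\<lambda>z. of_real (sqrt pi) * exp (\<beta> ^ 2 / (4 * r ^ 2)) * erf ((2 * r ^ 2 * z + \<beta>) / (2 * r)))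
    has_field_derivative 2 * r * exp (- (r ^ 2 * z ^ 2) - \<beta> * z)) (at z)"
proof -
  let ?u = "(2 * r ^ 2 * z + \<beta>) / (2 * r)"
  have "((\<lambda>z. erf ((2 * r ^ 2 * z + \<beta>) / (2 * r))) has_field_derivative
      2 / of_real (sqrt pi) * exp (- (?u ^ 2)) * r) (at z)"
    by (rule DERIV_chain2[where g = "\<lambda>z. (2 * r ^ 2 * z + \<beta>) / (2 * r)", OF erf_has_field_derivative])
       (use assms in \<open>auto intro!: derivative_eq_intros simp: power2_eq_square\<close>)
  from DERIV_cmult[OF this, of "of_real (sqrt pi) * exp (\<beta> ^ 2 / (4 * r ^ 2))"]
  have "((\<lambda>z. of_real (sqrt pi) * exp (\<beta> ^ 2 / (4 * r ^ 2)) * erf ((2 * r ^ 2 * z + \<beta>) / (2 * r)))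
    has_field_derivative 2 * r * (exp (\<beta> ^ 2 / (4 * r ^ 2)) * exp (- (?u ^ 2)))) (at z)"
    by (simp add: mult_ac)
  \<comment> \<open>Completing the square: the prefactor of erf is chosen so that exactly the
    Gaussian with linear term remains.\<close>
  moreover have "\<beta> ^ 2 / (4 * r ^ 2) + - (?u ^ 2) = - (r ^ 2 * z ^ 2) - \<beta> * z"
    using assms by (simp add: field_simps power2_eq_square)
  ultimately show ?thesis
    by (simp only: exp_add[symmetric])
qed

text \<open>With r = sqrt a, the fractional powers of a in \<open>V\<close> become natural powers of
  r, so the derivative checks reduce to polynomial algebra.\<close>

lemma powr_half_integers_of_square:
  fixes r :: real
  assumes "0 < r"
  shows "(r ^ 2) powr (3/2) = r ^ 3" "(r ^ 2) powr (5/2) = r ^ 5"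
proof -
  have "(r ^ 2) powr (real n / 2) = r ^ n" for n
  proof -
    have "(r ^ 2) powr (real n / 2) = (r powr real 2) powr (real n / 2)"
      using assms by (simp only: powr_realpow)
    also have "\<dots> = r powr real n"
      by (simp only: powr_powr) simp
    finally show ?thesis
      using assms by (simp only: powr_realpow)
  qed
  from this[of 3] this[of 5] show "(r ^ 2) powr (3/2) = r ^ 3" "(r ^ 2) powr (5/2) = r ^ 5"
    by simp_all
qed

lemma V_has_vector_derivative:
  assumes "0 < a"
  shows V_0_0_has_vector_derivative:
      "(V 0 0 a \<beta> has_vector_derivative V_E a \<beta> x) (at x)"
    and V_1_0_has_vector_derivative:
      "(V 1 0 a \<beta> has_vector_derivative of_real x * V_E a \<beta> x) (at x)"
    and V_2_0_has_vector_derivative: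
      "(V 2 0 a \<beta> has_vector_derivative of_real x ^ 2 * V_E a \<beta> x) (at x)"
    and V_minus_1_1_has_vector_derivative:
      "x \<noteq> 0 \<Longrightarrow> (V (- 1) 1 a \<beta> has_vector_derivative
         (\<beta> / of_real x + 1 / of_real x ^ 2) * V_E a \<beta> x) (at x)"
proof -
  define r where "r = sqrt a"
  have r: "0 < r" "a = r ^ 2"
    using assms by (simp_all add: r_def)
  have sqrt_r: "sqrt (r ^ 2) = r"
    using r(1) by simp
  define R where "R = complex_of_real r"
  have R: "R \<noteq> 0"
    using r by (simp add: R_def)
  define E where "E = (\<lambda>z. exp (- (R ^ 2 * z ^ 2) - \<beta> * z))"
  define W where "W = (\<lambda>z. of_real (sqrt pi) * exp (\<beta> ^ 2 / (4 * R ^ 2)) *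
    erf ((2 * R ^ 2 * z + \<beta>) / (2 * R)))"
  have V_E: "V_E (r ^ 2) \<beta> = (\<lambda>x. E (of_real x))"
    by (simp add: V_E_def E_def R_def fun_eq_iff)
  have V_W: "V_W (r ^ 2) \<beta> = (\<lambda>x. W (of_real x))"
    using r(1) by (simp add: V_W_def W_def R_def sqrt_r fun_eq_iff del: real_sqrt_abs)
  have E: "(E has_field_derivative (- (2 * R ^ 2 * z) - \<beta>) * E z) (at z)" for z
    unfolding E_def by (rule gaussian_linear_has_field_derivative)
  have W: "(W has_field_derivative 2 * R * E z) (at z)" for z
    unfolding E_def W_def by (rule erf_affine_has_field_derivative[OF R])
  show "(V 0 0 a \<beta> has_vector_derivative V_E a \<beta> x) (at x)"
  proof -
    have "((\<lambda>z. W z / (2 * R)) has_field_derivative E z) (at z)" for z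
      using DERIV_cdivide[OF W[of z], of "2 * R"] R by simp
    \<comment> \<open>A complex derivative at a real point restricts to the derivative along the
      real axis.\<close>
    from has_vector_derivative_real_field[OF this, of x UNIV] show ?thesis
      using r(1) by (simp add: V_def[abs_def] V_E V_W R_def r(2) sqrt_r del: real_sqrt_abs)
  qed
  show "(V 1 0 a \<beta> has_vector_derivative of_real x * V_E a \<beta> x) (at x)"
  proof -
    \<comment> \<open>The left-hand side is the literal output of the differentiation rules, with E'
      = (- 2 R^2 z - \<beta>) E and W' = 2 R E.\<close>
    have "- ((- (2 * R ^ 2 * z) - \<beta>) * E z) / (2 * R ^ 2) - \<beta> * (2 * R * E z) / (4 * R ^ 3) =
        z * E z" for z
      using R by (simp add: field_simps power2_eq_square power3_eq_cube)
    then have "((\<lambda>z. - E z / (2 * R ^ 2) - \<beta> * W z / (4 * R ^ 3)) has_field_derivative z * E z) (at z)" for z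
      by (rule DERIV_cong[rotated]) (intro DERIV_diff DERIV_cdivide DERIV_minus DERIV_cmult E W)
    from has_vector_derivative_real_field[OF this, of x UNIV] show ?thesis
      using r(1) by (simp add: V_def[abs_def] V_E V_W R_def r(2) powr_half_integers_of_square)
  qed
  show "(V 2 0 a \<beta> has_vector_derivative of_real x ^ 2 * V_E a \<beta> x) (at x)"
  proof -
    have "((0 - 2 * R ^ 2 * 1) * E z + (- (2 * R ^ 2 * z) - \<beta>) * E z * (\<beta> - 2 * R ^ 2 * z)) / (4 * (R ^ 2) ^ 2)
        + (2 * R ^ 2 + \<beta> ^ 2) * (2 * R * E z) / (8 * R ^ 5) = z ^ 2 * E z" for z
      using R by (simp add: field_simps eval_nat_numeral)
    then have "((\<lambda>z. (\<beta> - 2 * R ^ 2 * z) * E z / (4 * (R ^ 2) ^ 2) + (2 * R ^ 2 + \<beta> ^ 2) * W z / (8 * R ^ 5))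
        has_field_derivative z ^ 2 * E z) (at z)" for z
      by (rule DERIV_cong[rotated])
         (intro DERIV_add DERIV_diff DERIV_cdivide DERIV_mult DERIV_cmult DERIV_const DERIV_ident E W)
    from has_vector_derivative_real_field[OF this, of x UNIV] show ?thesis
      using r(1) by (simp add: V_def[abs_def] V_E V_W R_def r(2) powr_half_integers_of_square)
  qed
  show "(V (- 1) 1 a \<beta> has_vector_derivative (\<beta> / of_real x + 1 / of_real x ^ 2) * V_E a \<beta> x) (at x)"
    if "x \<noteq> 0"
  proof -
    \<comment> \<open>The term - 2 R^2 E from W cancels against the one from E' / z; what survives
      is \<beta> / z and, from differentiating 1 / z, the term 1 / z^2.\<close>
    have eq: "- R * (2 * R * E z) - ((- (2 * R ^ 2 * z) - \<beta>) * E z * z - E z * 1) / (z * z) =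
        (\<beta> / z + 1 / z ^ 2) * E z" if "z \<noteq> 0" for z
      using that by (simp add: field_simps power2_eq_square)
    have "((\<lambda>z. - R * W z - E z / z) has_field_derivative (\<beta> / z + 1 / z ^ 2) * E z) (at z)"
      if "z \<noteq> 0" for z
      by (rule DERIV_cong[OF _ eq[OF that]]) (intro DERIV_diff DERIV_cmult DERIV_divide E W DERIV_ident that)
    from has_vector_derivative_real_field[OF this, of x UNIV] show ?thesis
      using r(1) that by (simp add: V_def[abs_def] V_E V_W R_def r(2) sqrt_r del: real_sqrt_abs)
  qed
qed

section \<open>The functions V at purely imaginary argument\<close>

lemma V_E_imaginary:
  "V_E a (\<i> * of_real b) x = of_real (exp (- (a * x ^ 2))) * (of_real (cos (b * x)) - \<i> * of_real (sin (b * x)))"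
proof -
  have "V_E a (\<i> * of_real b) x = exp (of_real (- (a * x ^ 2))) * exp (- (\<i> * of_real (b * x)))"
    by (simp add: V_E_def mult.assoc flip: exp_add)
  then show ?thesis
    by (simp only: exp_of_real exp_minus_Euler cos_of_real sin_of_real)
qed

lemma V_E_minus_imaginary:
  "V_E a (- \<i> * of_real b) x = of_real (exp (- (a * x ^ 2))) * (of_real (cos (b * x)) + \<i> * of_real (sin (b * x)))"
  using V_E_imaginary[of a "- b" x] by simp

lemma V_W_imaginary:
  "V_W a (\<i> * of_real b) x = of_real (sqrt pi * exp (- (b ^ 2) / (4 * a))) *
     erf ((of_real (2 * a * x) + \<i> * of_real b) / of_real (2 * sqrt a))"
proof -
  have "(\<i> * of_real b) ^ 2 / (4 * of_real a) = complex_of_real (- (b ^ 2) / (4 * a))"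
    by (simp add: power_mult_distrib)
  then show ?thesis
    by (simp only: V_W_def exp_of_real of_real_mult)
qed

lemma V_W_minus_imaginary:
  "V_W a (- \<i> * of_real b) x = of_real (sqrt pi * exp (- (b ^ 2) / (4 * a))) *
     erf ((of_real (2 * a * x) - \<i> * of_real b) / of_real (2 * sqrt a))"
  using V_W_imaginary[of a "- b" x] by simp

text \<open>Serves twice: as the last equality of (ii), and to rewrite the antiderivative there into
  functions whose derivatives are known.\<close>

lemma V_minus_1_1_imaginary_sum:
  "of_real (sqrt pi * sqrt a * exp (- (b ^ 2) / (4 * a))) *
          erf ((of_real (2 * a * x) - \<i> * of_real b) / of_real (2 * sqrt a))
        + of_real (sqrt pi * sqrt a * exp (- (b ^ 2) / (4 * a))) *
          erf ((of_real (2 * a * x) + \<i> * of_real b) / of_real (2 * sqrt a))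
        + 1 / of_real x *
            (exp (- of_real (a * x ^ 2) - \<i> * of_real (b * x)) +
             exp (- of_real (a * x ^ 2) + \<i> * of_real (b * x)))
        = - V (-1) 1 a (\<i> * of_real b) x - V (-1) 1 a (- \<i> * of_real b) x"
proof -
  have V: "V (-1) 1 a \<beta> x = - of_real (sqrt a) * V_W a \<beta> x - V_E a \<beta> x / of_real x" for \<beta>
    by (simp add: V_def)
  have E: "V_E a (\<i> * of_real b) x = exp (- of_real (a * x ^ 2) - \<i> * of_real (b * x))"
    "V_E a (- \<i> * of_real b) x = exp (- of_real (a * x ^ 2) + \<i> * of_real (b * x))"
    by (simp_all add: V_E_def mult.assoc)
  show ?thesis
    unfolding V E V_W_imaginary V_W_minus_imaginary
    by (simp only: of_real_mult ring_distribs add_divide_distrib divide_inverse) (simp add: mult_ac add_ac)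
qed

section \<open>The integrals\<close>

text \<open>Since f and g agree, the derivative need only be compared with the elementary integrand
  g.\<close>

lemma indefinite_integrals_eqI:
  assumes "\<And>x. 0 < x \<Longrightarrow> f x = g x"
    and "\<And>x. 0 < x \<Longrightarrow> (F has_vector_derivative g x) (at x)"
  shows "indefinite_integrals_eq f g F"
  using assms by (simp add: indefinite_integrals_eq_def)

lemma sqrt_2_pi_mult: "sqrt (2 * pi) * sqrt (2 / pi) = 2"
  by (simp flip: real_sqrt_mult)

text \<open>The free factor c is the Gaussian in (iii) and the Gaussian over x in (ii).\<close>

lemma sqrt_mult_bessel_Y_three_halves:
  assumes "0 < b" "0 < x"
  shows "of_real (sqrt (2 * pi)) * (of_real (x powr (1/2) * c * b powr (3/2)) *
      bessel_Y (3/2) (of_real (b * x))) =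
    of_real (b * c * (- 2 * sin (b * x) - 2 * cos (b * x) / (b * x)))"
proof -
  have "of_real (sqrt (2 * pi)) * (of_real (x powr (1/2) * c * b powr (3/2)) *
      bessel_Y (3/2) (of_real (b * x))) =
    (of_real (sqrt (2 * pi) * (x powr (1/2) * c * b powr (3/2) *
      (sqrt (2 / pi) * (b * x) powr (- (1/2)) * (- sin (b * x) - cos (b * x) / (b * x))))) :: complex)"
    using assms by (subst bessel_Y_three_halves) auto
  also have "sqrt (2 * pi) * (x powr (1/2) * c * b powr (3/2) *
      (sqrt (2 / pi) * (b * x) powr (- (1/2)) * (- sin (b * x) - cos (b * x) / (b * x)))) =
    (sqrt (2 * pi) * sqrt (2 / pi)) * (x powr (1/2) * x powr (- (1/2))) *
      (b powr (3/2) * b powr (- (1/2))) * c * (- sin (b * x) - cos (b * x) / (b * x))"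
    using assms by (simp only: powr_mult mult_ac)
  also have "x powr (1/2) * x powr (- (1/2)) = 1"
    using assms by (simp flip: powr_add)
  also have "b powr (3/2) * b powr (- (1/2)) = b"
    using assms by (simp flip: powr_add)
  also note sqrt_2_pi_mult
  also have "2 * 1 * b * c * (- sin (b * x) - cos (b * x) / (b * x)) =
      b * c * (- 2 * sin (b * x) - 2 * cos (b * x) / (b * x))"
    by (simp add: algebra_simps)
  finally show ?thesis .
qed

theorem mainTheorem12:
  fixes a b :: real
  assumes "a > 0" and "b > 0"
  shows
    "(\<forall>p\<in>{0, 1, 2 :: int}.
        indefinite_integrals_eq
          (\<lambda>x. of_real (sqrt (2 * pi)) *
             (of_real (x powr (1/2 + of_int p) * exp (- a * x ^ 2) * b powr (1/2)) *
              bessel_Y (1/2) (of_real (b * x))))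
          (\<lambda>x. of_real (- (2 * exp (- a * x ^ 2) * x powi p * cos (b * x))))
          (\<lambda>x. - V p 0 a (\<i> * of_real b) x - V p 0 a (- \<i> * of_real b) x)) \<and>
     (\<forall>x>0. - V 0 0 a (\<i> * of_real b) x - V 0 0 a (- \<i> * of_real b) x =
        - of_real (sqrt pi / (2 * sqrt a) * exp (- (b ^ 2) / (4 * a))) *
          (erf ((of_real (2 * a * x) - \<i> * of_real b) / of_real (2 * sqrt a)) +
           erf ((of_real (2 * a * x) + \<i> * of_real b) / of_real (2 * sqrt a)))) \<and>
     indefinite_integrals_eq
       (\<lambda>x. of_real (sqrt (2 * pi)) *
          (of_real (x powr (1/2 - 1) * exp (- a * x ^ 2) * b powr (3/2)) *
           bessel_Y (3/2) (of_real (b * x))))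
       (\<lambda>x. of_real (b / x * exp (- a * x ^ 2) * (- 2 * sin (b * x) - 2 * cos (b * x) / (b * x))))
       (\<lambda>x. of_real (sqrt pi * sqrt a * exp (- (b ^ 2) / (4 * a))) *
              erf ((of_real (2 * a * x) - \<i> * of_real b) / of_real (2 * sqrt a))
          + of_real (sqrt pi * sqrt a * exp (- (b ^ 2) / (4 * a))) *
              erf ((of_real (2 * a * x) + \<i> * of_real b) / of_real (2 * sqrt a))
          + 1 / of_real x *
              (exp (- of_real (a * x ^ 2) - \<i> * of_real (b * x)) +
               exp (- of_real (a * x ^ 2) + \<i> * of_real (b * x)))) \<and>
     (\<forall>x>0.
        of_real (sqrt pi * sqrt a * exp (- (b ^ 2) / (4 * a))) *
          erf ((of_real (2 * a * x) - \<i> * of_real b) / of_real (2 * sqrt a))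
        + of_real (sqrt pi * sqrt a * exp (- (b ^ 2) / (4 * a))) *
          erf ((of_real (2 * a * x) + \<i> * of_real b) / of_real (2 * sqrt a))
        + 1 / of_real x *
            (exp (- of_real (a * x ^ 2) - \<i> * of_real (b * x)) +
             exp (- of_real (a * x ^ 2) + \<i> * of_real (b * x)))
        = - V (-1) 1 a (\<i> * of_real b) x - V (-1) 1 a (- \<i> * of_real b) x) \<and>
     indefinite_integrals_eq
       (\<lambda>x. of_real (sqrt (2 * pi)) *
          (of_real (x powr (1/2) * exp (- a * x ^ 2) * b powr (3/2)) *
           bessel_Y (3/2) (of_real (b * x))))
       (\<lambda>x. of_real (b * exp (- a * x ^ 2) * (- 2 * cos (b * x) / (b * x) - 2 * sin (b * x))))
       (\<lambda>x. - 2 * Upsilon_e 1 a (\<i> * of_real b) x - 2 * \<i> * of_real b * Upsilon_o 0 a (\<i> * of_real b) x)"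
proof (intro conjI ballI allI impI)
  let ?Ep = "\<lambda>x. V_E a (\<i> * of_real b) x" and ?Em = "\<lambda>x. V_E a (- \<i> * of_real b) x"
  fix p :: int
  assume p: "p \<in> {0, 1, 2}"
  have V: "(V p 0 a \<beta> has_vector_derivative of_real (x powi p) * V_E a \<beta> x) (at x)" for \<beta> x
    using p V_0_0_has_vector_derivative[OF \<open>a > 0\<close>, of \<beta> x] V_1_0_has_vector_derivative[OF \<open>a > 0\<close>, of \<beta> x]
      V_2_0_has_vector_derivative[OF \<open>a > 0\<close>, of \<beta> x]
    by auto
  show "indefinite_integrals_eq
          (\<lambda>x. of_real (sqrt (2 * pi)) *
             (of_real (x powr (1/2 + of_int p) * exp (- a * x ^ 2) * b powr (1/2)) *
              bessel_Y (1/2) (of_real (b * x))))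
          (\<lambda>x. of_real (- (2 * exp (- a * x ^ 2) * x powi p * cos (b * x))))
          (\<lambda>x. - V p 0 a (\<i> * of_real b) x - V p 0 a (- \<i> * of_real b) x)"
  proof (rule indefinite_integrals_eqI)
    fix x :: real assume x: "x > 0"
    have "of_real (sqrt (2 * pi)) * (of_real (x powr (1/2 + of_int p) * exp (- a * x ^ 2) * b powr (1/2)) *
        bessel_Y (1/2) (of_real (b * x))) =
      (of_real (sqrt (2 * pi) * (x powr (1/2 + of_int p) * exp (- a * x ^ 2) * b powr (1/2) *
        (- sqrt (2 / pi) * (b * x) powr (- (1/2)) * cos (b * x)))) :: complex)"
      using x \<open>b > 0\<close> by (subst bessel_Y_half) auto
    also have "sqrt (2 * pi) * (x powr (1/2 + of_int p) * exp (- a * x ^ 2) * b powr (1/2) *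
        (- sqrt (2 / pi) * (b * x) powr (- (1/2)) * cos (b * x))) =
      - (sqrt (2 * pi) * sqrt (2 / pi) * (x powr (1/2 + of_int p) * x powr (- (1/2))) *
        (b powr (1/2) * b powr (- (1/2))) * exp (- a * x ^ 2) * cos (b * x))"
      using x \<open>b > 0\<close> by (simp add: powr_mult)
    also have "x powr (1/2 + of_int p) * x powr (- (1/2)) = x powi p"
      using x by (simp add: powr_real_of_int' flip: powr_add)
    also have "b powr (1/2) * b powr (- (1/2)) = 1"
      using \<open>b > 0\<close> by (simp flip: powr_add)
    also note sqrt_2_pi_mult
    finally show "of_real (sqrt (2 * pi)) *
        (of_real (x powr (1/2 + of_int p) * exp (- a * x ^ 2) * b powr (1/2)) *
          bessel_Y (1/2) (of_real (b * x))) =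
        complex_of_real (- (2 * exp (- a * x ^ 2) * x powi p * cos (b * x)))"
      by (simp add: mult_ac)
    have "((\<lambda>x. - V p 0 a (\<i> * of_real b) x - V p 0 a (- \<i> * of_real b) x) has_vector_derivative
        - (of_real (x powi p) * ?Ep x) - of_real (x powi p) * ?Em x) (at x)"
      by (intro has_vector_derivative_diff has_vector_derivative_minus V)
    \<comment> \<open>The sine parts of the conjugate exponentials cancel and the cosine parts
      double.\<close>
    also have "- (of_real (x powi p) * ?Ep x) - of_real (x powi p) * ?Em x =
        of_real (- (2 * exp (- a * x ^ 2) * x powi p * cos (b * x)))"
      by (simp only: V_E_imaginary V_E_minus_imaginary) (simp add: algebra_simps)
    finally show "((\<lambda>x. - V p 0 a (\<i> * of_real b) x - V p 0 a (- \<i> * of_real b) x) has_vector_derivative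
        of_real (- (2 * exp (- a * x ^ 2) * x powi p * cos (b * x)))) (at x)" .
  qed
next
  fix x :: real
  show "- V 0 0 a (\<i> * of_real b) x - V 0 0 a (- \<i> * of_real b) x =
        - of_real (sqrt pi / (2 * sqrt a) * exp (- (b ^ 2) / (4 * a))) *
          (erf ((of_real (2 * a * x) - \<i> * of_real b) / of_real (2 * sqrt a)) +
           erf ((of_real (2 * a * x) + \<i> * of_real b) / of_real (2 * sqrt a)))"
  proof -
    have V: "V 0 0 a \<beta> x = V_W a \<beta> x / of_real (2 * sqrt a)" for \<beta>
      by (simp add: V_def)
    show ?thesis
      unfolding V V_W_imaginary V_W_minus_imaginary
      by (simp only: of_real_mult of_real_divide ring_distribs add_divide_distrib divide_inverse)
         (simp add: mult_ac add_ac)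
  qed
  show "of_real (sqrt pi * sqrt a * exp (- (b ^ 2) / (4 * a))) *
          erf ((of_real (2 * a * x) - \<i> * of_real b) / of_real (2 * sqrt a))
        + of_real (sqrt pi * sqrt a * exp (- (b ^ 2) / (4 * a))) *
          erf ((of_real (2 * a * x) + \<i> * of_real b) / of_real (2 * sqrt a))
        + 1 / of_real x *
            (exp (- of_real (a * x ^ 2) - \<i> * of_real (b * x)) +
             exp (- of_real (a * x ^ 2) + \<i> * of_real (b * x)))
        = - V (-1) 1 a (\<i> * of_real b) x - V (-1) 1 a (- \<i> * of_real b) x"
    by (rule V_minus_1_1_imaginary_sum)
next
  show "indefinite_integrals_eq
       (\<lambda>x. of_real (sqrt (2 * pi)) *
          (of_real (x powr (1/2 - 1) * exp (- a * x ^ 2) * b powr (3/2)) *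
           bessel_Y (3/2) (of_real (b * x))))
       (\<lambda>x. of_real (b / x * exp (- a * x ^ 2) * (- 2 * sin (b * x) - 2 * cos (b * x) / (b * x))))
       (\<lambda>x. of_real (sqrt pi * sqrt a * exp (- (b ^ 2) / (4 * a))) *
              erf ((of_real (2 * a * x) - \<i> * of_real b) / of_real (2 * sqrt a))
          + of_real (sqrt pi * sqrt a * exp (- (b ^ 2) / (4 * a))) *
              erf ((of_real (2 * a * x) + \<i> * of_real b) / of_real (2 * sqrt a))
          + 1 / of_real x *
              (exp (- of_real (a * x ^ 2) - \<i> * of_real (b * x)) +
               exp (- of_real (a * x ^ 2) + \<i> * of_real (b * x))))"
    unfolding V_minus_1_1_imaginary_sum
  proof (rule indefinite_integrals_eqI)
    fix x :: real assume x: "x > 0"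
    have "x powr (1/2 - 1) = x powr (1/2) / x"
      using x by (simp only: powr_diff) simp
    then show "of_real (sqrt (2 * pi)) * (of_real (x powr (1/2 - 1) * exp (- a * x ^ 2) * b powr (3/2)) *
           bessel_Y (3/2) (of_real (b * x))) =
        complex_of_real (b / x * exp (- a * x ^ 2) * (- 2 * sin (b * x) - 2 * cos (b * x) / (b * x)))"
      using sqrt_mult_bessel_Y_three_halves[OF \<open>b > 0\<close> x, of "exp (- a * x ^ 2) / x"]
      by (simp add: mult_ac)
    let ?d = "\<lambda>\<beta>. (\<beta> / of_real x + 1 / of_real x ^ 2) * V_E a \<beta> x"
    have "((\<lambda>x. - V (-1) 1 a (\<i> * of_real b) x - V (-1) 1 a (- \<i> * of_real b) x) has_vector_derivative
        - ?d (\<i> * of_real b) - ?d (- \<i> * of_real b)) (at x)"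
      using x by (intro has_vector_derivative_diff has_vector_derivative_minus
          V_minus_1_1_has_vector_derivative \<open>a > 0\<close>) auto
    \<comment> \<open>The opposite weights \<beta> / x pick out the sine parts, the equal weights 1
      / x^2 the cosine parts.\<close>
    also have "- ?d (\<i> * of_real b) - ?d (- \<i> * of_real b) =
        of_real (b / x * exp (- a * x ^ 2) * (- 2 * sin (b * x) - 2 * cos (b * x) / (b * x)))"
      using x \<open>b > 0\<close>
      by (simp only: V_E_imaginary V_E_minus_imaginary)
         (simp add: divide_simps power2_eq_square, simp add: algebra_simps)
    finally show "((\<lambda>x. - V (-1) 1 a (\<i> * of_real b) x - V (-1) 1 a (- \<i> * of_real b) x)
        has_vector_derivative
        of_real (b / x * exp (- a * x ^ 2) * (- 2 * sin (b * x) - 2 * cos (b * x) / (b * x)))) (at x)" .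
  qed
next
  show "indefinite_integrals_eq
       (\<lambda>x. of_real (sqrt (2 * pi)) *
          (of_real (x powr (1/2) * exp (- a * x ^ 2) * b powr (3/2)) *
           bessel_Y (3/2) (of_real (b * x))))
       (\<lambda>x. of_real (b * exp (- a * x ^ 2) * (- 2 * cos (b * x) / (b * x) - 2 * sin (b * x))))
       (\<lambda>x. - 2 * Upsilon_e 1 a (\<i> * of_real b) x - 2 * \<i> * of_real b * Upsilon_o 0 a (\<i> * of_real b) x)"
  proof (rule indefinite_integrals_eqI)
    fix x :: real assume x: "x > 0"
    have swap: "- 2 * cos (b * x) / (b * x) - 2 * sin (b * x) = - 2 * sin (b * x) - 2 * cos (b * x) / (b * x)"
      by simp
    show "of_real (sqrt (2 * pi)) * (of_real (x powr (1/2) * exp (- a * x ^ 2) * b powr (3/2)) *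
           bessel_Y (3/2) (of_real (b * x))) =
        complex_of_real (b * exp (- a * x ^ 2) * (- 2 * cos (b * x) / (b * x) - 2 * sin (b * x)))"
      unfolding swap by (rule sqrt_mult_bessel_Y_three_halves[OF \<open>b > 0\<close> x])
    \<comment> \<open>The antiderivative in real form: the minus sign of the even series and the
      product of \<open>- 2 * \<i> * b\<close> with the \<open>\<i>\<close> of the odd one make both
      coefficients real and positive.\<close>
    let ?G = "\<lambda>x. 2 * upper_Gamma_trig_series 0 a b x + 2 * b * upper_Gamma_trig_series 1 a b x"
    have "(upper_Gamma_trig_series 0 a b has_real_derivative
        - (x ^ 0 * exp (- (a * x ^ 2)) / x * cos (b * x))) (at x)"
      using \<open>a > 0\<close> x cos_sums_even[of "b * x"]
      by (intro upper_Gamma_trig_series_has_real_derivative) simp_all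
    moreover have "(upper_Gamma_trig_series 1 a b has_real_derivative
        - (x ^ 1 * exp (- (a * x ^ 2)) / x * sin (b * x))) (at x)"
      using \<open>a > 0\<close> x sin_sums_odd[of "b * x"]
      by (intro upper_Gamma_trig_series_has_real_derivative) simp_all
    ultimately have "(?G has_real_derivative
        2 * - (x ^ 0 * exp (- (a * x ^ 2)) / x * cos (b * x)) +
        2 * b * - (x ^ 1 * exp (- (a * x ^ 2)) / x * sin (b * x))) (at x)"
      by (intro DERIV_add DERIV_cmult)
    also have "2 * - (x ^ 0 * exp (- (a * x ^ 2)) / x * cos (b * x)) +
        2 * b * - (x ^ 1 * exp (- (a * x ^ 2)) / x * sin (b * x)) =
        b * exp (- a * x ^ 2) * (- 2 * cos (b * x) / (b * x) - 2 * sin (b * x))"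
      using x \<open>b > 0\<close> by (simp add: field_simps)
    finally have "((\<lambda>x. complex_of_real (?G x)) has_vector_derivative
        of_real (b * exp (- a * x ^ 2) * (- 2 * cos (b * x) / (b * x) - 2 * sin (b * x)))) (at x)"
      by (rule has_vector_derivative_of_real)
    then show "((\<lambda>x. - 2 * Upsilon_e 1 a (\<i> * of_real b) x - 2 * \<i> * of_real b * Upsilon_o 0 a (\<i> * of_real b) x)
        has_vector_derivative
        of_real (b * exp (- a * x ^ 2) * (- 2 * cos (b * x) / (b * x) - 2 * sin (b * x)))) (at x)"
    \<comment> \<open>The Upsilon identities are available for positive arguments, hence the
      transfer on the open half-line.\<close>
    proof (rule has_vector_derivative_transform_within_open[of _ _ _ "{0<..}"])
      fix y :: real assume "y \<in> {0<..}"
      then show "complex_of_real (?G y) =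
          - 2 * Upsilon_e 1 a (\<i> * of_real b) y - 2 * \<i> * of_real b * Upsilon_o 0 a (\<i> * of_real b) y"
        using \<open>a > 0\<close> by (simp add: Upsilon_e_imaginary Upsilon_o_imaginary algebra_simps)
    qed (use x in auto)
  qed
qed

end
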